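(* Let $L\ge 2$ be an integer, $A\in\mathbb{R}^{M\times N}$, $y\in\mathbb{R}^M$, and let $$\mathcal L^{\pm}(u,v)=\tfrac12\big\|A(u^{\odot L}-v^{\odot L})-y\big\|_2^2,\qquad u,v\in\mathbb{R}^N.$$ Let $u(t),v(t)$ ($t\ge 0$) follow the gradient flow $$u'(t)=-\nabla_u\mathcal L^{\pm}(u(t),v(t)),\quad u(0)=u_0>0,\qquad v'(t)=-\nabla_v\mathcal L^{\pm}(u(t),v(t)),\quad v(0)=v_0>0,$$ and put $\tilde u(t)=u(t)^{\odot L}$, $\tilde v(t)=v(t)^{\odot L}$. Suppose that $S=\{z\in\mathbb{R}^N: Az=y\}$ is non-empty. Then the limit $$\tilde x_\infty:=\lim_{t\to\infty}\big(\tilde u(t)-\tilde v(t)\big)$$ exists and is contained in $S$. Moreover, let $\gamma=1-\frac2L\in[0,1)$, $w_+=\tilde u(0)^{\odot(-\gamma)}$, $w_-=\tilde v(0)^{\odot(-\gamma)}$, $$\beta_1=\|\tilde u(0)\|_{w_+,1}+\|\tilde v(0)\|_{w_-,1},\qquad \beta_{\min}=\min_{n\in[N]}\min\big((w_+)_n\tilde u_n(0),\,(w_-)_n\tilde v_n(0)\big),$$ and $Q:=\min_{z\in S}\|z\|_{(w_+,w_-),1}$. Suppose $Q>\beta_1$. Then $$\|\tilde x_\infty\|_{(w_+,w_-),1}-Q\le \epsilon\, Q,\qquad\text{where}\qquad \epsilon:=\begin{cases}\dfrac{\log(\beta_1/\beta_{\min})}{\log(Q/\beta_1)} & \text{if }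 L=2,\\[8pt] \dfrac{L(\beta_1^{\gamma}-\beta_{\min}^{\gamma})}{2(Q^{\gamma}-\beta_1^{\gamma})} & \text{if } L>2.\end{cases}$$
   Context: $[N]=\{1,\dots,N\}$. For a vector $z$ and exponent $p$, $z^{\odot p}$ is the entrywise power; $\odot$ is the entrywise (Hadamard) product. $u_0>0$ means all entries are strictly positive. For $w>0$, $\|z\|_{w,1}:=\|w\odot z\|_1$. For $z\in\mathbb{R}^N$ let $z_+,z_-\ge 0$ be its positive and negative parts, $(z_+)_n=\max(z_n,0)$, $(z_-)_n=\max(-z_n,0)$, so $z=z_+-z_-$. For positive weight vectors $w_+,w_-$, the signed weighted $\ell_1$-norm is $\|z\|_{(w_+,w_-),1}:=\|w_+\odot z_++w_-\odot z_-\|_1$. *)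

theory Defs
  imports "HOL-Analysis.Analysis"
begin

text \<open>
  On \<^typ>\<open>real ^ 'n\<close> the library's \<open>x * z\<close> and \<open>x ^ k\<close> are entrywise, so they serve as the
  Hadamard product and the Hadamard power with a natural exponent. The library's \<open>0 < x\<close> on vectors
  does not mean that every entry is positive, so positivity is always stated entrywise.
\<close>

definition gradient :: "('a::real_inner \<Rightarrow> real) \<Rightarrow> 'a \<Rightarrow> 'a" where
  "gradient f x = (THE D. GDERIV f x :> D)"

lemma gradient_eqI:
  assumes "GDERIV f x :> D"
  shows "gradient f x = D"
  unfolding gradient_def
proof (rule the_equality)
  fix D' assume "GDERIV f x :> D'"
  with assms have "(\<lambda>h. h \<bullet> D') = (\<lambda>h. h \<bullet> D)"
    unfolding gderiv_def by (rule has_derivative_unique[rotated])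
  then show "D' = D"
    by (metis vector_eq_ldot)
qed (fact assms)

definition vec_powr :: "real ^ 'n \<Rightarrow> real \<Rightarrow> real ^ 'n" where
  "vec_powr x a = (\<chi> i. (x $ i) powr a)"

definition pos_part :: "real ^ 'n \<Rightarrow> real ^ 'n" where
  "pos_part z = (\<chi> i. max (z $ i) 0)"

definition neg_part :: "real ^ 'n \<Rightarrow> real ^ 'n" where
  "neg_part z = (\<chi> i. max (- (z $ i)) 0)"

definition l1_norm :: "real ^ 'n \<Rightarrow> real" where
  "l1_norm z = (\<Sum>i\<in>UNIV. \<bar>z $ i\<bar>)"

definition weighted_l1_norm :: "real ^ 'n \<Rightarrow> real ^ 'n \<Rightarrow> real" where
  "weighted_l1_norm w z = l1_norm (w * z)"

definition signed_weighted_l1_norm :: "real ^ 'n \<Rightarrow> real ^ 'n \<Rightarrow> real ^ 'n \<Rightarrow> real" where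
  "signed_weighted_l1_norm wp wm z = l1_norm (wp * pos_part z + wm * neg_part z)"

definition loss_pm :: "real ^ 'n ^ 'm \<Rightarrow> real ^ 'm \<Rightarrow> nat \<Rightarrow> real ^ 'n \<Rightarrow> real ^ 'n \<Rightarrow> real" where
  "loss_pm A y L u v = 1 / 2 * (norm (A *v (u ^ L - v ^ L) - y))\<^sup>2"

end

(*
  In the coordinates u, v the mirror-flow potential of the reparametrised dynamics is
  L/2 x^2 + p^L psi(x), with psi' = - L x^(1-L); it is minimal at x = p, and exceeds its minimum by
  at least L/2 (x - p)^2. Summed over all coordinates of u and v with a nonnegative target (p, q)
  such that A (p^L - q^L) = y, it has derivative - L^2 |residual|^2 along the flow, whatever the
  target. Hence the flow is bounded and the residual vanishes along some sequence of times; a cluster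
  point of the flow there is an admissible target, and monotonicity of its own energy forces
  convergence of the whole flow.

  Since the derivative does not depend on the target, the energy at time 0 above its infimum is
  least for the limit. Comparing the limit with a minimiser of the signed norm, and estimating the
  limit's side by the tangent of psi at the factor k = (Q / beta_1)^(1/L), the other side by the worst
  factor K = (Q / beta_min)^(1/L), gives the bound.
*)
theory Submission
  imports Defs
begin

section \<open>The scalar potential\<close>

text \<open>A primitive of - L x^(1-L) on x > 0. For L = 2 that power is 1/x, hence the logarithm;
  the two cases of the final error bound come from here.\<close>

definition psi :: "nat \<Rightarrow> real \<Rightarrow> real" where
  "psi L x = (if L = 2 then - 2 * ln x else real L / real (L - 2) * inverse x ^ (L - 2))"

text \<open>For p, x > 0, \<open>potential L p x - potential L p p\<close> is the Bregman divergence
  between p^L and x^L for the mirror map with derivative - psi(x) at x^L; for L = 2 it is the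
  Kullback-Leibler divergence.\<close>

definition potential :: "nat \<Rightarrow> real \<Rightarrow> real \<Rightarrow> real" where
  "potential L p x = real L / 2 * x\<^sup>2 + p ^ L * psi L x"

lemma psi_has_real_derivative:
  assumes "L \<ge> 2" "x > 0"
  shows "(psi L has_real_derivative - real L * inverse x ^ (L - 1)) (at x)"
proof (cases "L = 2")
  case True
  have "((\<lambda>x. - 2 * ln x) has_real_derivative - 2 * inverse x) (at x)"
    using assms(2) by (auto intro!: derivative_eq_intros simp: divide_inverse)
  with True show ?thesis by (simp add: psi_def[abs_def])
next
  case False
  with assms obtain k where L: "L = k + 3"
    by (metis add.commute le_add_diff_inverse le_antisym not_less_eq_eq numeral_2_eq_2 numeral_3_eq_3)
  have "((\<lambda>x. inverse x ^ Suc k) has_real_derivative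
      real (Suc k) * (inverse x ^ k * - (inverse x ^ Suc (Suc 0)))) (at x)"
    using assms(2) DERIV_power[OF DERIV_inverse[of x], of "Suc k"] by (simp add: algebra_simps)
  then have "((\<lambda>x. real L / real (Suc k) * inverse x ^ Suc k) has_real_derivative
      real L / real (Suc k) * (real (Suc k) * (inverse x ^ k * - (inverse x ^ Suc (Suc 0))))) (at x)"
    by (rule DERIV_cmult)
  also have "real L / real (Suc k) * (real (Suc k) * (inverse x ^ k * - (inverse x ^ Suc (Suc 0))))
      = - real L * inverse x ^ (L - 1)"
    by (simp add: L numeral_eq_Suc del: of_nat_Suc)
  finally have "((\<lambda>x. real L / real (L - 2) * inverse x ^ (L - 2)) has_real_derivative
      - real L * inverse x ^ (L - 1)) (at x)"
    using L by (simp add: numeral_eq_Suc)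
  with False show ?thesis by (simp add: psi_def[abs_def])
qed

text \<open>Convexity of \<open>psi L\<close> on x > 0 by elementary means: ln s <= s - 1 for L = 2,
  otherwise Bernoulli's inequality for a power of p/x.\<close>

lemma psi_tangent:
  assumes "L \<ge> 2" "p > 0" "x > 0"
  shows "psi L x \<ge> psi L p - real L * inverse p ^ (L - 1) * (x - p)"
proof (cases "L = 2")
  case True
  have "ln (x / p) \<le> x / p - 1"
    using assms by (intro ln_le_minus_one) simp
  with True assms show ?thesis
    by (simp add: psi_def ln_div field_simps)
next
  case False
  define k where "k = L - 2"
  have k: "k > 0" "L = k + 2" using False assms by (auto simp: k_def)
  \<comment> \<open>p/x + x/p >= 2 trades the line in x/p for the line in p/x to which Bernoulli
    applies.\<close>
  have "1 - real k * (x / p - 1) \<le> 1 + real k * (p / x - 1)"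
  proof -
    have "p / x + x / p - 2 = (x - p)\<^sup>2 / (x * p)"
      using assms by (simp add: field_simps power2_eq_square)
    then have "0 \<le> p / x + x / p - 2" using assms by simp
    then have "0 \<le> real k * (p / x + x / p - 2)" by simp
    then show ?thesis by (simp add: algebra_simps)
  qed
  also have "\<dots> \<le> (1 + (p / x - 1)) ^ k"
    using assms by (intro Bernoulli_inequality) simp
  finally have "1 - real k * (x / p - 1) \<le> (p / x) ^ k" by simp
  then have "real L / real k * inverse p ^ k * (1 - real k * (x / p - 1))
      \<le> real L / real k * inverse p ^ k * (p / x) ^ k"
    using assms by (intro mult_left_mono) auto
  also have "\<dots> = psi L x"
    using assms k by (simp add: psi_def power_divide power_inverse field_simps)
  also have "real L / real k * inverse p ^ k * (1 - real k * (x / p - 1))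
      = psi L p - real L * inverse p ^ (L - 1) * (x - p)"
    using assms k by (simp add: psi_def field_simps)
  finally show ?thesis .
qed

text \<open>For p > 0 the slope of \<open>psi L\<close> at p, times p^L, is - L p, so the tangent
  line and L/2 x^2 combine into a parabola with vertex p. For p = 0 equality holds.\<close>

lemma potential_ge:
  assumes "L \<ge> 2" "p \<ge> 0" "x > 0"
  shows "potential L p x \<ge> potential L p p + real L / 2 * (x - p)\<^sup>2"
proof (cases "p = 0")
  case True
  with assms show ?thesis by (simp add: potential_def power_0_left)
next
  case False
  with assms have p: "p > 0" by simp
  have L: "p ^ L * inverse p ^ (L - 1) = p"
    using p assms(1) by (cases L) (auto simp: field_simps)
  have "p ^ L * (psi L p - real L * inverse p ^ (L - 1) * (x - p)) \<le> p ^ L * psi L x"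
    using psi_tangent[OF assms(1) p assms(3)] p by (intro mult_left_mono) auto
  moreover have "p ^ L * (psi L p - real L * inverse p ^ (L - 1) * (x - p))
      = p ^ L * psi L p - real L * (p ^ L * inverse p ^ (L - 1)) * (x - p)"
    by (simp add: algebra_simps)
  ultimately show ?thesis
    unfolding L potential_def by (simp add: field_simps power2_eq_square)
qed

corollary potential_minimum:
  assumes "L \<ge> 2" "p \<ge> 0" "x > 0"
  shows "potential L p x \<ge> potential L p p"
proof -
  have "0 \<le> real L / 2 * (x - p)\<^sup>2" by simp
  with potential_ge[OF assms] show ?thesis by linarith
qed

text \<open>A limit of the flow may have zero coordinates, where \<open>psi L\<close> is singular.
  There the coefficient p^L vanishes and only the quadratic term is left.\<close>

lemma tendsto_potential:
  assumes "L \<ge> 2" "p \<ge> 0" "(f \<longlongrightarrow> p) F"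
  shows "((\<lambda>k. potential L p (f k)) \<longlongrightarrow> potential L p p) F"
proof (cases "p = 0")
  case True
  with assms show ?thesis
    unfolding potential_def by (auto intro!: tendsto_eq_intros simp: power_0_left)
next
  case False
  with assms have "isCont (psi L) p"
    by (intro DERIV_isCont[OF psi_has_real_derivative]) auto
  then have "((\<lambda>k. psi L (f k)) \<longlongrightarrow> psi L p) F"
    using assms(3) by (rule isCont_tendsto_compose)
  then show ?thesis
    unfolding potential_def using assms(3) by (intro tendsto_intros)
qed

text \<open>The integrating factor exp (- C) makes x * exp (- C) constant. The coefficient c may
  itself depend on the solution, which admits the nonlinear flow.\<close>

lemma linear_ode_pos:
  fixes x c :: "real \<Rightarrow> real"
  assumes c: "continuous_on {0..} c"
    and x: "\<And>t. t \<ge> 0 \<Longrightarrow> (x has_real_derivative c t * x t) (at t within {0..})"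
    and "x 0 > 0" "t \<ge> 0"
  shows "x t > 0"
proof -
  define C where "C = (\<lambda>s. integral {0..s} c)"
  have C: "(C has_real_derivative c s) (at s within {0..t})" if "s \<in> {0..t}" for s
    unfolding C_def using that c
    by (intro integral_has_real_derivative) (auto intro: continuous_on_subset)
  have "((\<lambda>s. x s * exp (- C s)) has_real_derivative 0) (at s within {0..t})"
    if "s \<in> {0..t}" for s
    using that C[OF that] DERIV_subset[OF x, of s "{0..t}"]
    by (auto intro!: derivative_eq_intros simp: algebra_simps)
  then have "\<exists>k. \<forall>s\<in>{0..t}. x s * exp (- C s) = k"
    by (intro has_field_derivative_zero_constant) auto
  then have "x t * exp (- C t) = x 0 * exp (- C 0)"
    using assms(4) by force
  then have "x t * exp (- C t) > 0" using assms(3) by simp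
  then show ?thesis by (simp add: zero_less_mult_iff)
qed

text \<open>The factor \<open>inverse x ^ (L - 1)\<close> is kept apart because it cancels the
  x^(L-1) in the velocity of the flow.\<close>

lemma potential_has_real_derivative:
  assumes "L \<ge> 2" "x > 0"
  shows "(potential L p has_real_derivative real L * (x ^ L - p ^ L) * inverse x ^ (L - 1)) (at x)"
proof -
  have x: "x ^ L * inverse x ^ (L - 1) = x"
    using assms by (cases L) (auto simp: field_simps)
  have "(potential L p has_real_derivative real L * (x ^ L * inverse x ^ (L - 1))
      - real L * p ^ L * inverse x ^ (L - 1)) (at x)"
    unfolding potential_def[abs_def] x
    by (auto intro!: derivative_eq_intros psi_has_real_derivative assms simp: algebra_simps)
  then show ?thesis by (simp add: algebra_simps)
qed

section \<open>The gradient of the loss\<close>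

lemma vec_power_component: "(x ^ k) $ n = (x $ n) ^ k" for x :: "'a::comm_ring_1 ^ 'n"
  by (induction k) simp_all

lemma tendsto_vec_power:
  fixes p :: "real ^ 'n"
  assumes "(f \<longlongrightarrow> p) F"
  shows "((\<lambda>k. f k ^ L) \<longlongrightarrow> p ^ L) F"
  by (rule vec_tendstoI) (auto simp: vec_power_component intro!: tendsto_intros assms)

lemma has_derivative_vec_power:
  fixes x :: "real ^ 'n"
  shows "((\<lambda>x. x ^ k) has_derivative (\<lambda>h. of_nat k * x ^ (k - 1) * h)) (at x)"
proof -
  have "((\<lambda>x. \<chi> n. (x $ n) ^ k) has_derivative (\<lambda>h. \<chi> n. real k * (x $ n) ^ (k - 1) * h $ n)) (at x)"
    unfolding has_derivative_componentwise_within[of "\<lambda>x. \<chi> n. (x $ n) ^ k"]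
    by (auto simp: Basis_vec_def inner_axis algebra_simps
        intro!: derivative_eq_intros bounded_linear_imp_has_derivative bounded_linear_vec_nth)
  moreover have "(\<lambda>x. \<chi> n. (x $ n) ^ k) = (\<lambda>x::real ^ 'n. x ^ k)"
    by (simp add: fun_eq_iff vec_eq_iff vec_power_component)
  moreover have "(\<lambda>h. \<chi> n. real k * (x $ n) ^ (k - 1) * h $ n) = (\<lambda>h. of_nat k * x ^ (k - 1) * h)"
    by (simp add: fun_eq_iff vec_eq_iff vec_power_component of_nat_index)
  ultimately show ?thesis by simp
qed

text \<open>Chain rule; \<open>r v* A\<close> is the transpose of A applied to r, and the Hadamard
  factor moves across the inner product.\<close>

lemma gradient_loss_pm:
  fixes A :: "real ^ 'n ^ 'm"
  shows "gradient (\<lambda>a. loss_pm A y L a b) a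
    = of_nat L * a ^ (L - 1) * ((A *v (a ^ L - b ^ L) - y) v* A)"
proof (rule gradient_eqI)
  let ?r = "\<lambda>a. A *v (a ^ L - b ^ L) - y"
  have r: "(?r has_derivative (\<lambda>h. A *v (of_nat L * a ^ (L - 1) * h))) (at a)"
    by (auto intro!: derivative_eq_intros has_derivative_vec_power
        bounded_linear.has_derivative[OF matrix_vector_mul_bounded_linear])
  have "((\<lambda>a. 1 / 2 * (?r a \<bullet> ?r a)) has_derivative
      (\<lambda>h. ?r a \<bullet> (A *v (of_nat L * a ^ (L - 1) * h)))) (at a)"
    by (rule has_derivative_eq_rhs[OF has_derivative_mult_right[OF has_derivative_inner[OF r r]]])
      (simp add: inner_commute)
  moreover have "?r a \<bullet> (A *v (of_nat L * a ^ (L - 1) * h))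
      = h \<bullet> (of_nat L * a ^ (L - 1) * (?r a v* A))" for h
    unfolding dot_lmul_matrix[symmetric]
    by (simp add: inner_vec_def algebra_simps)
  ultimately show "GDERIV (\<lambda>a. loss_pm A y L a b) a
    :> of_nat L * a ^ (L - 1) * (?r a v* A)"
    by (simp add: gderiv_def loss_pm_def power2_norm_eq_inner)
qed

text \<open>This symmetry reduces the gradient in v to the one in u, with y negated.\<close>

lemma loss_pm_swap: "loss_pm A y L u v = loss_pm A (- y) L v u"
proof -
  have "A *v (u ^ L - v ^ L) - y = - (A *v (v ^ L - u ^ L) - (- y))"
    by (simp add: matrix_vector_mult_diff_distrib)
  then show ?thesis
    unfolding loss_pm_def by (simp only: norm_minus_cancel)
qed

lemma gradient_loss_pm_snd:
  fixes A :: "real ^ 'n ^ 'm"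
  shows "gradient (\<lambda>b. loss_pm A y L a b) b
    = - (of_nat L * b ^ (L - 1) * ((A *v (a ^ L - b ^ L) - y) v* A))"
proof -
  have "A *v (b ^ L - a ^ L) - (- y) = - (A *v (a ^ L - b ^ L) - y)"
    by (simp add: matrix_vector_mult_diff_distrib)
  then have "(A *v (b ^ L - a ^ L) - (- y)) v* A = - ((A *v (a ^ L - b ^ L) - y) v* A)"
    by (simp only:) (simp add: vec_eq_iff vector_matrix_mult_def sum_negf[symmetric] algebra_simps)
  then show ?thesis
    unfolding loss_pm_swap[of A y] gradient_loss_pm by simp
qed

section \<open>Convergence of the flow\<close>

lemma norm_vec_sq: "(norm x)\<^sup>2 = (\<Sum>n\<in>UNIV. (x $ n)\<^sup>2)" for x :: "real ^ 'n"
  by (simp add: power2_norm_eq_inner inner_vec_def) (simp add: power2_eq_square)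

locale hadamard_flow =
  fixes L :: nat and A :: "real ^ 'n ^ 'm" and y :: "real ^ 'm" and u v :: "real \<Rightarrow> real ^ 'n"
  assumes L_ge_2: "L \<ge> 2"
    and u_init: "\<And>n. u 0 $ n > 0"
    and v_init: "\<And>n. v 0 $ n > 0"
    and u_flow: "\<And>t. t \<ge> 0 \<Longrightarrow>
      (u has_vector_derivative - gradient (\<lambda>a. loss_pm A y L a (v t)) (u t)) (at t within {0..})"
    and v_flow: "\<And>t. t \<ge> 0 \<Longrightarrow>
      (v has_vector_derivative - gradient (\<lambda>b. loss_pm A y L (u t) b) (v t)) (at t within {0..})"
begin

definition residual :: "real \<Rightarrow> real ^ 'm" where
  "residual t = A *v (u t ^ L - v t ^ L) - y"

definition energy :: "real ^ 'n \<Rightarrow> real ^ 'n \<Rightarrow> real \<Rightarrow> real" where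
  "energy p q t = (\<Sum>n\<in>UNIV. potential L (p $ n) (u t $ n) + potential L (q $ n) (v t $ n))"

definition energy_inf :: "real ^ 'n \<Rightarrow> real ^ 'n \<Rightarrow> real" where
  "energy_inf p q = (\<Sum>n\<in>UNIV. potential L (p $ n) (p $ n) + potential L (q $ n) (q $ n))"

section \<open>Coordinate equations and positivity of the flow\<close>

lemma u_deriv:
  assumes "t \<ge> 0"
  shows "((\<lambda>t. u t $ n) has_real_derivative
    - (real L * (u t $ n) ^ (L - 1) * (residual t v* A) $ n)) (at t within {0..})"
  using bounded_linear.has_vector_derivative[OF bounded_linear_vec_nth u_flow[OF assms], of n]
  by (simp add: gradient_loss_pm residual_def vec_power_component of_nat_index
      has_real_derivative_iff_has_vector_derivative)

lemma v_deriv: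
  assumes "t \<ge> 0"
  shows "((\<lambda>t. v t $ n) has_real_derivative
    real L * (v t $ n) ^ (L - 1) * (residual t v* A) $ n) (at t within {0..})"
  using bounded_linear.has_vector_derivative[OF bounded_linear_vec_nth v_flow[OF assms], of n]
  by (simp add: gradient_loss_pm_snd residual_def vec_power_component of_nat_index
      has_real_derivative_iff_has_vector_derivative)

lemma continuous_on_u: "continuous_on {0..} (\<lambda>t. u t $ n)"
  and continuous_on_v: "continuous_on {0..} (\<lambda>t. v t $ n)"
  by (auto intro!: DERIV_continuous_on u_deriv v_deriv)

lemma continuous_on_residual: "continuous_on {0..} (\<lambda>t. (residual t v* A) $ n)"
  unfolding residual_def vector_matrix_mult_def matrix_vector_mult_def
  by (auto simp: vec_power_component intro!: continuous_intros continuous_on_u continuous_on_v)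

text \<open>L >= 2 allows one factor u to be split off u^(L-1), so each coordinate solves a linear
  equation whose coefficient is continuous along the given flow.\<close>

lemma u_pos: "u t $ n > 0" if "t \<ge> 0"
proof (rule linear_ode_pos[where x = "\<lambda>t. u t $ n", OF _ _ u_init that])
  show "continuous_on {0..} (\<lambda>t. - (real L * (u t $ n) ^ (L - 2) * (residual t v* A) $ n))"
    by (intro continuous_intros continuous_on_u continuous_on_residual)
  obtain k where "L = Suc (Suc k)"
    using L_ge_2 by (metis Suc_le_D numeral_2_eq_2 Suc_le_mono)
  then show "((\<lambda>t. u t $ n) has_real_derivative
      - (real L * (u t $ n) ^ (L - 2) * (residual t v* A) $ n) * u t $ n) (at t within {0..})"
    if "t \<ge> 0" for t
    using u_deriv[OF that, of n] by (simp add: algebra_simps)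
qed

lemma v_pos: "v t $ n > 0" if "t \<ge> 0"
proof (rule linear_ode_pos[where x = "\<lambda>t. v t $ n", OF _ _ v_init that])
  show "continuous_on {0..} (\<lambda>t. real L * (v t $ n) ^ (L - 2) * (residual t v* A) $ n)"
    by (intro continuous_intros continuous_on_v continuous_on_residual)
  obtain k where "L = Suc (Suc k)"
    using L_ge_2 by (metis Suc_le_D numeral_2_eq_2 Suc_le_mono)
  then show "((\<lambda>t. v t $ n) has_real_derivative
      real L * (v t $ n) ^ (L - 2) * (residual t v* A) $ n * v t $ n) (at t within {0..})"
    if "t \<ge> 0" for t
    using v_deriv[OF that, of n] by (simp add: algebra_simps)
qed

text \<open>The powers of u and v cancel, leaving the transpose of A applied to the residual, paired
  with (u^L - v^L) - (p^L - q^L). Moving A across and using A (p^L - q^L) = y turns both factors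
  into the residual.\<close>

lemma energy_has_real_derivative:
  assumes "t \<ge> 0" "A *v (p ^ L - q ^ L) = y"
  shows "(energy p q has_real_derivative - (real L)\<^sup>2 * (norm (residual t))\<^sup>2) (at t within {0..})"
proof -
  let ?g = "residual t v* A"
  have cancel: "inverse x ^ (L - 1) * x ^ (L - 1) = 1" if "x > 0" for x :: real
    using that by (simp add: power_mult_distrib[symmetric])
  have "((\<lambda>t. potential L (p $ n) (u t $ n)) has_real_derivative
      - (real L)\<^sup>2 * (((u t $ n) ^ L - (p $ n) ^ L) * ?g $ n)) (at t within {0..})" for n
  proof -
    have "((\<lambda>t. potential L (p $ n) (u t $ n)) has_real_derivative
        real L * ((u t $ n) ^ L - (p $ n) ^ L) * inverse (u t $ n) ^ (L - 1) *
        - (real L * (u t $ n) ^ (L - 1) * ?g $ n)) (at t within {0..})"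
      by (rule DERIV_chain2[OF potential_has_real_derivative[OF L_ge_2 u_pos[OF assms(1)]] u_deriv[OF assms(1)]])
    also have "real L * ((u t $ n) ^ L - (p $ n) ^ L) * inverse (u t $ n) ^ (L - 1) *
        - (real L * (u t $ n) ^ (L - 1) * ?g $ n) =
      - (real L)\<^sup>2 * (((u t $ n) ^ L - (p $ n) ^ L) * ?g $ n) * (inverse (u t $ n) ^ (L - 1) * (u t $ n) ^ (L - 1))"
      by (simp add: power2_eq_square algebra_simps)
    finally show ?thesis unfolding cancel[OF u_pos[OF assms(1)]] by simp
  qed
  moreover have "((\<lambda>t. potential L (q $ n) (v t $ n)) has_real_derivative
      (real L)\<^sup>2 * (((v t $ n) ^ L - (q $ n) ^ L) * ?g $ n)) (at t within {0..})" for n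
  proof -
    have "((\<lambda>t. potential L (q $ n) (v t $ n)) has_real_derivative
        real L * ((v t $ n) ^ L - (q $ n) ^ L) * inverse (v t $ n) ^ (L - 1) *
        (real L * (v t $ n) ^ (L - 1) * ?g $ n)) (at t within {0..})"
      by (rule DERIV_chain2[OF potential_has_real_derivative[OF L_ge_2 v_pos[OF assms(1)]] v_deriv[OF assms(1)]])
    also have "real L * ((v t $ n) ^ L - (q $ n) ^ L) * inverse (v t $ n) ^ (L - 1) *
        (real L * (v t $ n) ^ (L - 1) * ?g $ n) =
      (real L)\<^sup>2 * (((v t $ n) ^ L - (q $ n) ^ L) * ?g $ n) * (inverse (v t $ n) ^ (L - 1) * (v t $ n) ^ (L - 1))"
      by (simp add: power2_eq_square algebra_simps)
    finally show ?thesis unfolding cancel[OF v_pos[OF assms(1)]] by simp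
  qed
  ultimately have "(energy p q has_real_derivative
      (\<Sum>n\<in>UNIV. - (real L)\<^sup>2 * (((u t $ n) ^ L - (p $ n) ^ L) * ?g $ n)
        + (real L)\<^sup>2 * (((v t $ n) ^ L - (q $ n) ^ L) * ?g $ n))) (at t within {0..})"
    unfolding energy_def[abs_def] by (intro DERIV_sum DERIV_add)
  also have "(\<Sum>n\<in>UNIV. - (real L)\<^sup>2 * (((u t $ n) ^ L - (p $ n) ^ L) * ?g $ n)
        + (real L)\<^sup>2 * (((v t $ n) ^ L - (q $ n) ^ L) * ?g $ n))
      = - (real L)\<^sup>2 * (?g \<bullet> ((u t ^ L - v t ^ L) - (p ^ L - q ^ L)))"
    unfolding inner_vec_def sum_distrib_left
    by (intro sum.cong) (simp_all add: vec_power_component algebra_simps)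
  also have "?g \<bullet> ((u t ^ L - v t ^ L) - (p ^ L - q ^ L)) = (norm (residual t))\<^sup>2"
    unfolding dot_lmul_matrix
    by (simp only: matrix_vector_mult_diff_distrib[of A "u t ^ L - v t ^ L"] assms(2) power2_norm_eq_inner residual_def)
  finally show ?thesis .
qed

lemma energy_ge:
  assumes "t \<ge> 0" "\<And>n. p $ n \<ge> 0" "\<And>n. q $ n \<ge> 0"
  shows "energy p q t \<ge> energy_inf p q + real L / 2 * ((norm (u t - p))\<^sup>2 + (norm (v t - q))\<^sup>2)"
proof -
  have "energy_inf p q + real L / 2 * ((norm (u t - p))\<^sup>2 + (norm (v t - q))\<^sup>2) =
    (\<Sum>n\<in>UNIV. (potential L (p $ n) (p $ n) + real L / 2 * (u t $ n - p $ n)\<^sup>2)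
      + (potential L (q $ n) (q $ n) + real L / 2 * (v t $ n - q $ n)\<^sup>2))"
    unfolding energy_inf_def norm_vec_sq
    by (simp add: sum.distrib sum_distrib_left distrib_left)
  also have "\<dots> \<le> energy p q t"
    unfolding energy_def
    by (intro sum_mono add_mono potential_ge L_ge_2 assms u_pos v_pos)
  finally show ?thesis .
qed

lemma dist_sq_le_energy:
  assumes "t \<ge> 0" "\<And>n. p $ n \<ge> 0" "\<And>n. q $ n \<ge> 0"
  shows "(norm (u t - p))\<^sup>2 + (norm (v t - q))\<^sup>2 \<le> energy p q t - energy_inf p q"
proof -
  have "1 * ((norm (u t - p))\<^sup>2 + (norm (v t - q))\<^sup>2)
      \<le> real L / 2 * ((norm (u t - p))\<^sup>2 + (norm (v t - q))\<^sup>2)"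
    using L_ge_2 by (intro mult_right_mono) auto
  also have "\<dots> \<le> energy p q t - energy_inf p q"
    using energy_ge[OF assms] by simp
  finally show ?thesis by simp
qed

lemma energy_inf_le:
  assumes "t \<ge> 0" "\<And>n. p $ n \<ge> 0" "\<And>n. q $ n \<ge> 0"
  shows "energy_inf p q \<le> energy p q t"
proof -
  have "0 \<le> (norm (u t - p))\<^sup>2 + (norm (v t - q))\<^sup>2" by simp
  with dist_sq_le_energy[OF assms] show ?thesis by linarith
qed

section \<open>Energy decay and its consequences\<close>

lemma energy_mvt:
  assumes "0 \<le> s" "s \<le> t" "A *v (p ^ L - q ^ L) = y"
  shows "\<exists>x\<in>{s..t}. energy p q t - energy p q s = - (real L)\<^sup>2 * (norm (residual x))\<^sup>2 * (t - s)"
proof (rule mvt_very_simple[OF assms(2)])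
  fix x assume "s \<le> x" "x \<le> t"
  then have "(energy p q has_real_derivative - (real L)\<^sup>2 * (norm (residual x))\<^sup>2) (at x within {s..t})"
    using assms by (intro DERIV_subset[OF energy_has_real_derivative]) auto
  then show "(energy p q has_derivative (\<lambda>h. - (real L)\<^sup>2 * (norm (residual x))\<^sup>2 * h)) (at x within {s..t})"
    unfolding has_field_derivative_def .
qed

lemma energy_antimono:
  assumes "0 \<le> s" "s \<le> t" "A *v (p ^ L - q ^ L) = y"
  shows "energy p q t \<le> energy p q s"
proof -
  obtain x where "energy p q t - energy p q s = - ((real L)\<^sup>2 * (norm (residual x))\<^sup>2 * (t - s))"
    using energy_mvt[OF assms] by auto
  moreover have "(real L)\<^sup>2 * (norm (residual x))\<^sup>2 * (t - s) \<ge> 0"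
    using assms by simp
  ultimately show ?thesis by linarith
qed

text \<open>All feasible targets share one energy derivative. This carries information from the
  limit t -> \<infinity> back to time 0.\<close>

lemma energy_diff_const:
  assumes "t \<ge> 0" "A *v (p ^ L - q ^ L) = y" "A *v (p' ^ L - q' ^ L) = y"
  shows "energy p q t - energy p' q' t = energy p q 0 - energy p' q' 0"
proof -
  have "\<exists>c. \<forall>t\<in>{0..}. energy p q t - energy p' q' t = c"
    using DERIV_diff[OF energy_has_real_derivative[OF _ assms(2)] energy_has_real_derivative[OF _ assms(3)]]
    by (intro has_field_derivative_zero_constant) auto
  then show ?thesis using assms(1) by force
qed

text \<open>By the mean value theorem on [0, k+1], at some time L^2 |residual|^2 is the average
  energy loss, at most C/(k+1). The chosen times may stay bounded; the later use of decreasing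
  energy allows for that.\<close>

lemma vanishing_residual_sequence:
  assumes "A *v (p ^ L - q ^ L) = y" "\<And>n. p $ n \<ge> 0" "\<And>n. q $ n \<ge> 0"
  obtains s :: "nat \<Rightarrow> real" where "\<And>k. s k \<ge> 0" "(\<lambda>k. residual (s k)) \<longlonglongrightarrow> 0"
proof -
  define C where "C = energy p q 0 - energy_inf p q"
  have "\<exists>s\<ge>0. (norm (residual s))\<^sup>2 \<le> C / real (Suc k)" for k
  proof -
    obtain s where s: "s \<in> {0..real (Suc k)}"
      "energy p q (real (Suc k)) - energy p q 0 = - ((real L)\<^sup>2 * (norm (residual s))\<^sup>2 * real (Suc k))"
      using energy_mvt[of 0 "real (Suc k)", OF _ _ assms(1)] by auto
    have "energy p q (real (Suc k)) \<ge> energy_inf p q"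
      by (intro energy_inf_le assms) simp
    then have "(real L)\<^sup>2 * ((norm (residual s))\<^sup>2 * real (Suc k)) \<le> C"
      using s(2) unfolding C_def by (simp add: algebra_simps)
    moreover have "1 * ((norm (residual s))\<^sup>2 * real (Suc k)) \<le> (real L)\<^sup>2 * ((norm (residual s))\<^sup>2 * real (Suc k))"
      using L_ge_2 by (intro mult_right_mono) auto
    ultimately have "(norm (residual s))\<^sup>2 * real (Suc k) \<le> C" by linarith
    then have "(norm (residual s))\<^sup>2 \<le> C / real (Suc k)"
      by (simp add: pos_le_divide_eq del: of_nat_Suc)
    with s(1) show ?thesis by auto
  qed
  then obtain s where s: "\<And>k. s k \<ge> 0" "\<And>k. (norm (residual (s k)))\<^sup>2 \<le> C / real (Suc k)"
    by metis
  have "(\<lambda>k. (norm (residual (s k)))\<^sup>2) \<longlonglongrightarrow> 0"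
  proof (rule tendsto_sandwich[OF _ _ tendsto_const])
    show "(\<lambda>k. C / real (Suc k)) \<longlonglongrightarrow> 0"
      using LIMSEQ_Suc[OF lim_const_over_n[of C]] by simp
  qed (use s(2) in auto)
  then have "(\<lambda>k. norm (residual (s k))) \<longlonglongrightarrow> 0"
    using tendsto_real_sqrt[of "\<lambda>k. (norm (residual (s k)))\<^sup>2" 0] by simp
  then have "(\<lambda>k. residual (s k)) \<longlonglongrightarrow> 0"
    by (rule tendsto_norm_zero_cancel)
  with s(1) show thesis by (rule that)
qed

lemma tendsto_energy:
  assumes "\<And>n. p $ n \<ge> 0" "\<And>n. q $ n \<ge> 0"
    and "((\<lambda>k. u (s k)) \<longlongrightarrow> p) F" "((\<lambda>k. v (s k)) \<longlongrightarrow> q) F"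
  shows "((\<lambda>k. energy p q (s k)) \<longlongrightarrow> energy_inf p q) F"
  unfolding energy_def energy_inf_def
  by (intro tendsto_sum tendsto_add tendsto_potential L_ge_2 assms(1,2) tendsto_vec_nth assms(3,4))

lemma flow_converges:
  assumes feasible: "A *v (a ^ L - b ^ L) = y" "\<And>n. a $ n \<ge> 0" "\<And>n. b $ n \<ge> 0"
  obtains p q where "\<And>n. p $ n \<ge> 0" "\<And>n. q $ n \<ge> 0" "A *v (p ^ L - q ^ L) = y"
    "(u \<longlongrightarrow> p) at_top" "(v \<longlongrightarrow> q) at_top"
proof -
  obtain s where s: "\<And>k. s k \<ge> 0" "(\<lambda>k. residual (s k)) \<longlonglongrightarrow> 0"
    using vanishing_residual_sequence[OF feasible] by blast
  \<comment> \<open>Squared radius of a ball around (a, b) that contains the whole flow.\<close>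
  define R where "R = energy a b 0 - energy_inf a b"
  have R: "(norm (u t - a))\<^sup>2 + (norm (v t - b))\<^sup>2 \<le> R" if "t \<ge> 0" for t
    using dist_sq_le_energy[OF that feasible(2,3)] energy_antimono[OF order_refl that feasible(1)]
    unfolding R_def by linarith
  have "dist (a, b) (u (s k), v (s k)) \<le> sqrt R" for k
    using R[OF s(1)[of k]] by (simp add: dist_Pair_Pair dist_norm norm_minus_commute norm_Pair)
  then have "bounded (range (\<lambda>k. (u (s k), v (s k))))"
    unfolding bounded_def by blast
  then obtain l and r :: "nat \<Rightarrow> nat" where r: "strict_mono r"
    and l: "((\<lambda>k. (u (s k), v (s k))) \<circ> r) \<longlonglongrightarrow> l"
    using bounded_imp_convergent_subsequence by blast
  obtain p q where pq: "l = (p, q)" by (cases l)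
  have lu: "(\<lambda>k. u (s (r k))) \<longlonglongrightarrow> p" and lv: "(\<lambda>k. v (s (r k))) \<longlonglongrightarrow> q"
    using tendsto_fst[OF l] tendsto_snd[OF l] by (simp_all add: pq o_def)
  have p: "p $ n \<ge> 0" for n
    by (rule tendsto_lowerbound[OF tendsto_vec_nth[OF lu]]) (simp_all add: less_imp_le[OF u_pos[OF s(1)]])
  have q: "q $ n \<ge> 0" for n
    by (rule tendsto_lowerbound[OF tendsto_vec_nth[OF lv]]) (simp_all add: less_imp_le[OF v_pos[OF s(1)]])
  have "(\<lambda>k. residual (s (r k))) \<longlonglongrightarrow> A *v (p ^ L - q ^ L) - y"
    unfolding residual_def
    by (intro tendsto_diff bounded_linear.tendsto[OF matrix_vector_mul_bounded_linear]
        tendsto_vec_power lu lv tendsto_const)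
  moreover have "(\<lambda>k. residual (s (r k))) \<longlonglongrightarrow> 0"
    using LIMSEQ_subseq_LIMSEQ[OF s(2) r] by (simp add: o_def)
  ultimately have feas: "A *v (p ^ L - q ^ L) = y"
    using LIMSEQ_unique by fastforce
  \<comment> \<open>The cluster point has just been shown feasible, so it can replace (a, b) as the
    target of the energy.\<close>
  have e: "(\<lambda>k. energy p q (s (r k))) \<longlonglongrightarrow> energy_inf p q"
    by (rule tendsto_energy[OF p q lu lv])
  have conv: "\<forall>\<^sub>F t in at_top. (norm (u t - p))\<^sup>2 + (norm (v t - q))\<^sup>2 < \<epsilon>" if "\<epsilon> > 0" for \<epsilon>
  proof -
    have "\<forall>\<^sub>F k in sequentially. energy p q (s (r k)) < energy_inf p q + \<epsilon>"
      using e that by (intro order_tendstoD) auto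
    \<comment> \<open>One good index is enough: the energy decreases, so its bound persists at all
      later times.\<close>
    then obtain k where k: "energy p q (s (r k)) < energy_inf p q + \<epsilon>"
      using eventually_sequentially by auto
    have "(norm (u t - p))\<^sup>2 + (norm (v t - q))\<^sup>2 < \<epsilon>" if "t \<ge> s (r k)" for t
    proof -
      have t: "t \<ge> 0" using that s(1)[of "r k"] by linarith
      from dist_sq_le_energy[OF t p q] energy_antimono[OF s(1) that feas] k
      show ?thesis by linarith
    qed
    then show ?thesis unfolding eventually_at_top_linorder by blast
  qed
  have "\<forall>\<^sub>F t in at_top. dist (u t) p < e" and "\<forall>\<^sub>F t in at_top. dist (v t) q < e"
    if e: "e > 0" for e
  proof -
    have "norm (u t - p) < e \<and> norm (v t - q) < e"
      if "(norm (u t - p))\<^sup>2 + (norm (v t - q))\<^sup>2 < e\<^sup>2" for t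
    proof -
      have "(norm (u t - p))\<^sup>2 < e\<^sup>2" "(norm (v t - q))\<^sup>2 < e\<^sup>2"
        using that zero_le_power2[of "norm (u t - p)"] zero_le_power2[of "norm (v t - q)"]
        by linarith+
      with e show ?thesis by (auto intro: power2_less_imp_less)
    qed
    with conv[of "e\<^sup>2"] e
    show "\<forall>\<^sub>F t in at_top. dist (u t) p < e" "\<forall>\<^sub>F t in at_top. dist (v t) q < e"
      by (auto simp: dist_norm elim!: eventually_mono)
  qed
  then have "(u \<longlongrightarrow> p) at_top" "(v \<longlongrightarrow> q) at_top"
    by (auto intro: tendstoI)
  then show thesis using that p q feas by blast
qed

text \<open>The energies of (a, b) and (p, q) differ by a constant in time. In
  \<open>energy_inf a b \<le> energy a b t\<close> the right side therefore tends to
  \<open>energy_inf p q\<close> plus that constant.\<close>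

lemma limit_minimal:
  assumes "\<And>n. p $ n \<ge> 0" "\<And>n. q $ n \<ge> 0" "A *v (p ^ L - q ^ L) = y"
    and "(u \<longlongrightarrow> p) at_top" "(v \<longlongrightarrow> q) at_top"
    and "\<And>n. a $ n \<ge> 0" "\<And>n. b $ n \<ge> 0" "A *v (a ^ L - b ^ L) = y"
  shows "energy p q 0 - energy_inf p q \<le> energy a b 0 - energy_inf a b"
proof -
  have "((\<lambda>t. energy p q t) \<longlongrightarrow> energy_inf p q) at_top"
    using tendsto_energy[where s = "\<lambda>t. t"] assms by simp
  then have "((\<lambda>t. energy p q t + (energy a b 0 - energy p q 0)) \<longlongrightarrow>
      energy_inf p q + (energy a b 0 - energy p q 0)) at_top"
    by (intro tendsto_intros)
  moreover have "\<forall>\<^sub>F t in at_top. energy_inf a b \<le> energy p q t + (energy a b 0 - energy p q 0)"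
    unfolding eventually_at_top_linorder
  proof (intro exI[of _ 0] allI impI)
    fix t :: real assume t: "t \<ge> 0"
    from energy_inf_le[OF t assms(6,7)] energy_diff_const[OF t assms(8,3)]
    show "energy_inf a b \<le> energy p q t + (energy a b 0 - energy p q 0)" by linarith
  qed
  ultimately have "energy_inf a b \<le> energy_inf p q + (energy a b 0 - energy p q 0)"
    by (rule tendsto_lowerbound) simp
  then show ?thesis by simp
qed

end

section \<open>Comparison with the minimal signed norm\<close>

lemma power_eq_mult_square:
  fixes x :: real
  assumes "L \<ge> 2"
  shows "x ^ L = x ^ (L - 2) * x\<^sup>2"
  using assms power_add[of x "L - 2" 2] by (simp only: le_add_diff_inverse2)

text \<open>Normalised drop of \<open>psi L\<close> when its argument grows by the factor k: 2 ln k
  for L = 2, and L/(L-2) * (1 - k^(-(L-2))) for L > 2.\<close>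

definition psi_gain :: "nat \<Rightarrow> real \<Rightarrow> real" where
  "psi_gain L k = psi L 1 - psi L k"

text \<open>For p = k * x this is p^L * psi(x) - potential(p, p) per unit of the weighted mass
  x^(-(L-2)) * p^L.\<close>

definition psi_margin :: "nat \<Rightarrow> real \<Rightarrow> real" where
  "psi_margin L k = psi_gain L k - real L / 2 * inverse k ^ (L - 2)"

text \<open>\<open>psi L\<close> is homogeneous of degree -(L-2), or logarithmic for L = 2, so x
  enters the drop from x to k * x only through the weight.\<close>

lemma psi_scale:
  assumes "k > 0" "x > 0"
  shows "psi L x - psi L (k * x) = inverse x ^ (L - 2) * psi_gain L k"
  using assms by (simp add: psi_gain_def psi_def ln_mult power_mult_distrib algebra_simps)

text \<open>Up to an additive constant the margin is 2 ln k or a negative multiple of k^(-(L-2)),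
  both increasing.\<close>

lemma psi_margin_mono:
  assumes "L \<ge> 2" "0 < k" "k \<le> K"
  shows "psi_margin L k \<le> psi_margin L K"
proof (cases "L = 2")
  case True
  with assms show ?thesis by (simp add: psi_margin_def psi_gain_def psi_def)
next
  case False
  have "inverse K ^ (L - 2) \<le> inverse k ^ (L - 2)"
    using assms by (intro power_mono) (auto simp: le_imp_inverse_le)
  then have "(real L / real (L - 2) + real L / 2) * inverse K ^ (L - 2)
      \<le> (real L / real (L - 2) + real L / 2) * inverse k ^ (L - 2)"
    by (intro mult_left_mono) auto
  with False show ?thesis by (simp add: psi_margin_def psi_gain_def psi_def algebra_simps)
qed

text \<open>Since p minimises \<open>potential L p\<close>, any test point bounds the minimum from
  above. The point k * x, with k free of p, gives a bound affine in p^L.\<close>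

lemma psi_gap_ge:
  assumes "L \<ge> 2" "p \<ge> 0" "x > 0" "k > 0"
  shows "p ^ L * psi L x - potential L p p
    \<ge> inverse x ^ (L - 2) * p ^ L * psi_gain L k - real L / 2 * k\<^sup>2 * x\<^sup>2"
proof -
  have "potential L p p \<le> potential L p (k * x)"
    using assms by (intro potential_minimum) auto
  moreover have "p ^ L * psi L x - p ^ L * psi L (k * x) = inverse x ^ (L - 2) * p ^ L * psi_gain L k"
    unfolding right_diff_distrib[symmetric] psi_scale[OF assms(4,3)] by simp
  ultimately show ?thesis
    by (simp add: potential_def power_mult_distrib algebra_simps)
qed

text \<open>For p > 0 equality holds with the factor p/x in place of K; monotonicity of the margin
  passes to K.\<close>

lemma psi_gap_le:
  assumes "L \<ge> 2" "p \<ge> 0" "x > 0" "p \<le> K * x"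
  shows "p ^ L * psi L x - potential L p p \<le> inverse x ^ (L - 2) * p ^ L * psi_margin L K"
proof (cases "p = 0")
  case True
  with assms show ?thesis by (simp add: potential_def power_0_left)
next
  case False
  with assms have p: "p > 0" by simp
  define k where "k = p / x"
  have k: "k > 0" "k * x = p" using p assms by (simp_all add: k_def)
  have kK: "k \<le> K" using assms by (simp add: k_def pos_divide_le_eq)
  have "p ^ L * psi L x - p ^ L * psi L (k * x) = inverse x ^ (L - 2) * p ^ L * psi_gain L k"
    unfolding right_diff_distrib[symmetric] psi_scale[OF k(1) assms(3)] by simp
  moreover have "p\<^sup>2 = inverse x ^ (L - 2) * p ^ L * inverse k ^ (L - 2)"
  proof -
    have "p ^ L = p ^ (L - 2) * p\<^sup>2"
      using assms(1) by (rule power_eq_mult_square)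
    then show ?thesis
      using p assms(3) by (simp add: k_def power_divide field_simps)
  qed
  ultimately have "p ^ L * psi L x - potential L p p
      = inverse x ^ (L - 2) * p ^ L * psi_margin L k"
    using k(2) by (simp add: potential_def psi_margin_def algebra_simps)
  also have "\<dots> \<le> inverse x ^ (L - 2) * p ^ L * psi_margin L K"
    using assms p by (intro mult_left_mono psi_margin_mono k kK) auto
  finally show ?thesis .
qed

context hadamard_flow
begin

text \<open>The quadratic part of the initial energy does not involve the target and cancels when
  two targets are compared.\<close>

lemma energy_gap:
  "energy p q 0 - energy_inf p q =
    real L / 2 * (\<Sum>n\<in>UNIV. (u 0 $ n)\<^sup>2 + (v 0 $ n)\<^sup>2) +
    (\<Sum>n\<in>UNIV. ((p $ n) ^ L * psi L (u 0 $ n) - potential L (p $ n) (p $ n)) +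
      ((q $ n) ^ L * psi L (v 0 $ n) - potential L (q $ n) (q $ n)))"
  unfolding energy_def energy_inf_def potential_def[of L _ "u 0 $ _"] potential_def[of L _ "v 0 $ _"]
  by (simp add: sum.distrib sum_subtractf sum_distrib_left distrib_left)

text \<open>For nonnegative p and q this dominates the signed norm of p^L - q^L, with equality if p
  and q have disjoint supports.\<close>

definition weighted_mass :: "real ^ 'n \<Rightarrow> real ^ 'n \<Rightarrow> real" where
  "weighted_mass p q = (\<Sum>n\<in>UNIV. inverse (u 0 $ n) ^ (L - 2) * (p $ n) ^ L +
    inverse (v 0 $ n) ^ (L - 2) * (q $ n) ^ L)"

text \<open>Optimality at time 0 is put between two scalar bounds: the uniform factor k linearises
  the side of (p, q), and K dominates all entrywise ratios on the side of (a, b).\<close>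

lemma limit_mass_bound:
  assumes pq: "\<And>n. p $ n \<ge> 0" "\<And>n. q $ n \<ge> 0" "A *v (p ^ L - q ^ L) = y"
      "(u \<longlongrightarrow> p) at_top" "(v \<longlongrightarrow> q) at_top"
    and ab: "\<And>n. a $ n \<ge> 0" "\<And>n. b $ n \<ge> 0" "A *v (a ^ L - b ^ L) = y"
      "\<And>n. a $ n \<le> K * u 0 $ n" "\<And>n. b $ n \<le> K * v 0 $ n"
    and k: "k > 0" "k ^ L * (\<Sum>n\<in>UNIV. (u 0 $ n)\<^sup>2 + (v 0 $ n)\<^sup>2) = weighted_mass a b"
  shows "psi_gain L k * (weighted_mass p q - weighted_mass a b)
    \<le> weighted_mass a b * (psi_margin L K - psi_margin L k)"
proof -
  define \<beta> where "\<beta> = (\<Sum>n\<in>UNIV. (u 0 $ n)\<^sup>2 + (v 0 $ n)\<^sup>2)"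
  have "psi_gain L k * weighted_mass p q - real L / 2 * k\<^sup>2 * \<beta> =
      (\<Sum>n\<in>UNIV. (inverse (u 0 $ n) ^ (L - 2) * (p $ n) ^ L * psi_gain L k - real L / 2 * k\<^sup>2 * (u 0 $ n)\<^sup>2) +
        (inverse (v 0 $ n) ^ (L - 2) * (q $ n) ^ L * psi_gain L k - real L / 2 * k\<^sup>2 * (v 0 $ n)\<^sup>2))"
    unfolding weighted_mass_def \<beta>_def sum_distrib_left sum_subtractf[symmetric]
    by (intro sum.cong) (simp_all add: algebra_simps)
  also have "\<dots> \<le> (\<Sum>n\<in>UNIV. ((p $ n) ^ L * psi L (u 0 $ n) - potential L (p $ n) (p $ n)) +
      ((q $ n) ^ L * psi L (v 0 $ n) - potential L (q $ n) (q $ n)))"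
    by (intro sum_mono add_mono psi_gap_ge L_ge_2 pq k(1) u_init v_init)
  also have "\<dots> \<le> (\<Sum>n\<in>UNIV. ((a $ n) ^ L * psi L (u 0 $ n) - potential L (a $ n) (a $ n)) +
      ((b $ n) ^ L * psi L (v 0 $ n) - potential L (b $ n) (b $ n)))"
    using limit_minimal[OF pq ab(1-3)] unfolding energy_gap by simp
  also have "\<dots> \<le> (\<Sum>n\<in>UNIV. inverse (u 0 $ n) ^ (L - 2) * (a $ n) ^ L * psi_margin L K +
      inverse (v 0 $ n) ^ (L - 2) * (b $ n) ^ L * psi_margin L K)"
    by (intro sum_mono add_mono psi_gap_le L_ge_2 ab u_init v_init)
  also have "\<dots> = weighted_mass a b * psi_margin L K"
    unfolding weighted_mass_def sum_distrib_right distrib_right ..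
  finally have "psi_gain L k * weighted_mass p q - real L / 2 * k\<^sup>2 * \<beta> \<le> weighted_mass a b * psi_margin L K" .
  \<comment> \<open>The choice of k makes the quadratic remainder match the term by which
    \<open>psi_margin L k\<close> falls short of \<open>psi_gain L k\<close>.\<close>
  moreover have "k\<^sup>2 * \<beta> = weighted_mass a b * inverse k ^ (L - 2)"
  proof -
    have "k ^ L = k ^ (L - 2) * k\<^sup>2" by (rule power_eq_mult_square[OF L_ge_2])
    then have "k ^ L * inverse k ^ (L - 2) = k\<^sup>2" using k(1) by (simp add: field_simps)
    moreover have "weighted_mass a b * inverse k ^ (L - 2) = (k ^ L * inverse k ^ (L - 2)) * \<beta>"
      unfolding k(2)[symmetric] \<beta>_def by simp
    ultimately show ?thesis by simp
  qed
  then have "real L / 2 * k\<^sup>2 * \<beta> = real L / 2 * (weighted_mass a b * inverse k ^ (L - 2))" by simp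
  ultimately have "psi_gain L k * weighted_mass p q - real L / 2 * (weighted_mass a b * inverse k ^ (L - 2))
      \<le> weighted_mass a b * psi_margin L K" by (simp only:)
  then show ?thesis
    by (simp add: psi_margin_def[of L k] algebra_simps)
qed

end

section \<open>Closed form of the error constant\<close>

lemma powr_root_power:
  assumes "L \<ge> 2" "x > 0"
  shows "(x powr (1 / real L)) ^ (L - 2) = x powr (1 - 2 / real L)"
proof -
  have "(x powr (1 / real L)) ^ (L - 2) = x powr (real (L - 2) * (1 / real L))"
    using assms by (simp add: powr_power mult.commute)
  also have "real (L - 2) * (1 / real L) = 1 - 2 / real L"
    using assms by (simp add: of_nat_diff field_simps)
  finally show ?thesis .
qed

lemma psi_gain_pos:
  assumes "L \<ge> 2" "k > 1"
  shows "psi_gain L k > 0"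
proof (cases "L = 2")
  case True
  with assms show ?thesis by (simp add: psi_gain_def psi_def)
next
  case False
  have "inverse k ^ (L - 2) < 1"
    using assms False by (intro power_less_one_iff[THEN iffD2]) (auto simp: inverse_less_1_iff)
  moreover have "psi_gain L k = real L / real (L - 2) * (1 - inverse k ^ (L - 2))"
    using False by (simp add: psi_gain_def psi_def right_diff_distrib)
  ultimately show ?thesis using False assms(1) by simp
qed

text \<open>For L > 2, the powers of order L - 2 of the L-th roots become powers of order \<gamma>,
  and the common denominator Q^\<gamma> cancels. For L = 2 the constants in the margins
  cancel.\<close>

lemma margin_ratio:
  fixes \<beta> m Q :: real
  assumes "L \<ge> 2" "0 < m" "0 < \<beta>" "\<beta> < Q"
  defines "\<gamma> \<equiv> 1 - 2 / real L"
  shows "(psi_margin L ((Q / m) powr (1 / real L)) - psi_margin L ((Q / \<beta>) powr (1 / real L)))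
      / psi_gain L ((Q / \<beta>) powr (1 / real L)) =
    (if L = 2 then ln (\<beta> / m) / ln (Q / \<beta>)
     else real L * (\<beta> powr \<gamma> - m powr \<gamma>) / (2 * (Q powr \<gamma> - \<beta> powr \<gamma>)))"
proof (cases "L = 2")
  case True
  have "psi_gain 2 (x powr (1 / 2)) = ln x" if "x > 0" for x
    using that by (simp add: psi_gain_def psi_def ln_powr)
  with True assms show ?thesis
    by (simp add: psi_margin_def ln_div)
next
  case False
  define X B M where "X = Q powr \<gamma>" and "B = \<beta> powr \<gamma>" and "M = m powr \<gamma>"
  have \<gamma>: "\<gamma> > 0" using False assms by (simp add: \<gamma>_def)
  have X: "0 < B" "B < X" using assms \<gamma> by (auto simp: X_def B_def intro: powr_less_mono2)
  have k: "inverse ((Q / \<beta>) powr (1 / real L)) ^ (L - 2) = B / X"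
    and K: "inverse ((Q / m) powr (1 / real L)) ^ (L - 2) = M / X"
    unfolding power_inverse X_def B_def M_def \<gamma>_def
    using assms by (subst powr_root_power; simp add: powr_divide)+
  \<comment> \<open>The identity c + L/2 = c * L/2 lets c cancel in the quotient and leaves the
    factor L/2 of the bound.\<close>
  define c where "c = real L / real (L - 2)"
  have c: "c > 0" "c + real L / 2 = c * (real L / 2)"
    using False assms by (auto simp: c_def of_nat_diff field_simps)
  have "psi_margin L ((Q / m) powr (1 / real L)) - psi_margin L ((Q / \<beta>) powr (1 / real L))
      = (c + real L / 2) * ((B - M) / X)"
    using False by (simp add: psi_margin_def psi_gain_def psi_def k K c_def diff_divide_distrib algebra_simps)
  moreover have "psi_gain L ((Q / \<beta>) powr (1 / real L)) = c * ((X - B) / X)"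
    using False X by (simp add: psi_gain_def psi_def k c_def diff_divide_distrib algebra_simps)
  ultimately show ?thesis
    using False X c(1) unfolding c(2) by (simp add: X_def[symmetric] B_def[symmetric] M_def[symmetric])
qed

section \<open>The signed norm, its minimiser and entrywise estimates\<close>

lemma signed_weighted_l1_norm_eq:
  assumes "\<And>n. wp $ n \<ge> 0" "\<And>n. wm $ n \<ge> 0"
  shows "signed_weighted_l1_norm wp wm z =
    (\<Sum>n\<in>UNIV. wp $ n * max (z $ n) 0 + wm $ n * max (- (z $ n)) 0)"
  using assms by (simp add: signed_weighted_l1_norm_def l1_norm_def pos_part_def neg_part_def)

text \<open>Positive weights make the norm coercive, so its sublevel sets within S are compact. This
  justifies encoding the minimum Q as an infimum.\<close>

lemma signed_weighted_l1_norm_attains_min: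
  fixes S :: "(real ^ 'n) set"
  assumes wp: "\<And>n. wp $ n > 0" and wm: "\<And>n. wm $ n > 0" and "closed S" "S \<noteq> {}"
  shows "\<exists>z\<in>S. signed_weighted_l1_norm wp wm z = (INF z\<in>S. signed_weighted_l1_norm wp wm z)"
proof -
  let ?f = "signed_weighted_l1_norm wp wm"
  have f: "?f z = (\<Sum>n\<in>UNIV. wp $ n * max (z $ n) 0 + wm $ n * max (- (z $ n)) 0)" for z
    using wp wm by (intro signed_weighted_l1_norm_eq) (auto intro: less_imp_le)
  have cont: "continuous_on T ?f" for T
    unfolding f[abs_def] by (intro continuous_intros)
  obtain z0 where z0: "z0 \<in> S" using assms by auto
  define T where "T = S \<inter> {z. ?f z \<le> ?f z0}"
  have "norm z \<le> (\<Sum>n\<in>UNIV. ?f z0 / min (wp $ n) (wm $ n))" if "z \<in> T" for z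
  proof -
    have "\<bar>z $ n\<bar> \<le> ?f z0 / min (wp $ n) (wm $ n)" for n
    proof -
      have "min (wp $ n) (wm $ n) * \<bar>z $ n\<bar> \<le> wp $ n * max (z $ n) 0 + wm $ n * max (- (z $ n)) 0"
        using wp[of n] wm[of n] by (cases "z $ n \<ge> 0") (auto simp: max_def mult_right_mono)
      also have "\<dots> \<le> ?f z"
        unfolding f using less_imp_le[OF wp] less_imp_le[OF wm]
        by (intro member_le_sum add_nonneg_nonneg mult_nonneg_nonneg) simp_all
      finally show ?thesis
        using that wp[of n] wm[of n] unfolding T_def by (simp add: pos_le_divide_eq mult.commute)
    qed
    then show ?thesis
      by (intro order_trans[OF norm_le_l1_cart] sum_mono)
  qed
  then have "bounded T" by (auto simp: bounded_iff)
  moreover have "closed T"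
    unfolding T_def using assms cont by (intro closed_Int closed_Collect_le) auto
  ultimately have "compact T" by (simp add: compact_eq_bounded_closed)
  moreover have "z0 \<in> T" using z0 by (simp add: T_def)
  ultimately obtain z where z: "z \<in> T" "\<And>x. x \<in> T \<Longrightarrow> ?f z \<le> ?f x"
    using continuous_attains_inf[OF _ _ cont[of T]] by blast
  \<comment> \<open>On S outside T the value exceeds that at z0, which lies in T, so a minimiser on
    T is one on S.\<close>
  have "?f z \<le> ?f x" if "x \<in> S" for x
    using z(2)[of x] z(2)[OF \<open>z0 \<in> T\<close>] that by (cases "x \<in> T") (auto simp: T_def)
  then have "(INF z\<in>S. ?f z) = ?f z"
    using z by (intro cInf_eq_minimum) (auto simp: T_def)
  with z show ?thesis by (metis IntD1 T_def)
qed

text \<open>L * (1 - 2/L) = L - 2, so the real powers in the weights are natural powers.\<close>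

lemma power_powr_eq_inverse_power:
  assumes "L \<ge> 2" "x > 0"
  shows "(x ^ L) powr - (1 - 2 / real L) = inverse x ^ (L - 2)"
proof -
  have "(x ^ L) powr - (1 - 2 / real L) = x powr (real L * - (1 - 2 / real L))"
    using assms by (simp add: powr_powr flip: powr_realpow)
  also have "real L * - (1 - 2 / real L) = - real (L - 2)"
    using assms by (simp add: of_nat_diff field_simps)
  also have "x powr - real (L - 2) = inverse x ^ (L - 2)"
    using assms by (simp add: powr_minus powr_realpow power_inverse del: of_nat_diff)
  finally show ?thesis .
qed

text \<open>A weighted term of at most Q gives a^L <= Q * x^(L-2); m <= x^2 supplies the two missing
  factors x at the price 1/m.\<close>

lemma le_mult_root:
  fixes x a Q m :: real
  assumes "L \<ge> 2" "x > 0" "a \<ge> 0" "Q > 0" "0 < m" "m \<le> x\<^sup>2"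
    and "inverse x ^ (L - 2) * a ^ L \<le> Q"
  shows "a \<le> (Q / m) powr (1 / real L) * x"
proof -
  have "a ^ L = (inverse x ^ (L - 2) * a ^ L) * x ^ (L - 2)"
    using assms(2) by (simp add: field_simps)
  also have "\<dots> \<le> Q * x ^ (L - 2)"
    using assms by (intro mult_right_mono) auto
  also have "\<dots> \<le> Q / m * (x ^ (L - 2) * x\<^sup>2)"
  proof -
    have "Q * x ^ (L - 2) * m \<le> Q * x ^ (L - 2) * x\<^sup>2"
      using assms by (intro mult_left_mono) auto
    then show ?thesis using assms(5) by (simp add: field_simps)
  qed
  also have "x ^ (L - 2) * x\<^sup>2 = x ^ L"
    using power_eq_mult_square[OF assms(1), of x] by simp
  also have "Q / m * x ^ L = ((Q / m) powr (1 / real L) * x) ^ L"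
    using assms by (simp add: power_mult_distrib powr_power)
  finally show ?thesis
    using assms by (intro power_le_imp_le_base[of a "L - 1"]) auto
qed

text \<open>Turns any vector into a target in the coordinates u and v; the disjoint supports make
  its weighted mass equal to the signed norm.\<close>

lemma split_root:
  fixes z :: "real ^ 'n"
  assumes "L > 0"
  obtains a b where "\<And>n. a $ n \<ge> 0" "\<And>n. b $ n \<ge> 0" "z = a ^ L - b ^ L"
    "\<And>n. (a $ n) ^ L = max (z $ n) 0" "\<And>n. (b $ n) ^ L = max (- (z $ n)) 0"
proof
  let ?a = "\<chi> n. root L (max (z $ n) 0)" and ?b = "\<chi> n. root L (max (- (z $ n)) 0)"
  show "?a $ n \<ge> 0" "?b $ n \<ge> 0" "(?a $ n) ^ L = max (z $ n) 0" "(?b $ n) ^ L = max (- (z $ n)) 0" for n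
    using assms by simp_all
  then show "z = ?a ^ L - ?b ^ L"
    unfolding vec_eq_iff vector_minus_component vec_power_component by (simp add: max_def)
qed

section \<open>Assembly of convergence and error bound\<close>

theorem theorem1p1:
  fixes L :: nat
    and A :: "real ^ 'n ^ 'm"
    and y :: "real ^ 'm"
    and u v :: "real \<Rightarrow> real ^ 'n"
    and u0 v0 :: "real ^ 'n"
  defines "ut \<equiv> (\<lambda>t. u t ^ L)"
    and "vt \<equiv> (\<lambda>t. v t ^ L)"
    and "S \<equiv> {z. A *v z = y}"
    and "\<gamma> \<equiv> 1 - 2 / real L"
  defines "wp \<equiv> vec_powr (ut 0) (- \<gamma>)"
    and "wm \<equiv> vec_powr (vt 0) (- \<gamma>)"
  defines "\<beta>1 \<equiv> weighted_l1_norm wp (ut 0) + weighted_l1_norm wm (vt 0)"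
    and "\<beta>_min \<equiv> (MIN n. min (wp $ n * ut 0 $ n) (wm $ n * vt 0 $ n))"
    and "Q \<equiv> (INF z\<in>S. signed_weighted_l1_norm wp wm z)"
  defines "\<epsilon> \<equiv> (if L = 2 then ln (\<beta>1 / \<beta>_min) / ln (Q / \<beta>1)
                else real L * (\<beta>1 powr \<gamma> - \<beta>_min powr \<gamma>) / (2 * (Q powr \<gamma> - \<beta>1 powr \<gamma>)))"
  assumes "L \<ge> 2"
    and "\<And>n. u0 $ n > 0" and "\<And>n. v0 $ n > 0"
    and "u 0 = u0" and "v 0 = v0"
    and "\<And>t. t \<ge> 0 \<Longrightarrow>
      (u has_vector_derivative - gradient (\<lambda>a. loss_pm A y L a (v t)) (u t)) (at t within {0..})"
    and "\<And>t. t \<ge> 0 \<Longrightarrow>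
      (v has_vector_derivative - gradient (\<lambda>b. loss_pm A y L (u t) b) (v t)) (at t within {0..})"
    and "S \<noteq> {}"
  shows "(\<exists>z\<in>S. signed_weighted_l1_norm wp wm z = Q) \<and>
    (\<exists>x_inf. ((\<lambda>t. ut t - vt t) \<longlongrightarrow> x_inf) at_top \<and> x_inf \<in> S \<and>
       (Q > \<beta>1 \<longrightarrow> signed_weighted_l1_norm wp wm x_inf - Q \<le> \<epsilon> * Q))"
proof -
  interpret hadamard_flow L A y u v
    using assms by unfold_locales auto
  have wp: "wp $ n = inverse (u 0 $ n) ^ (L - 2)" and wm: "wm $ n = inverse (v 0 $ n) ^ (L - 2)" for n
    by (simp_all add: wp_def wm_def ut_def vt_def \<gamma>_def vec_powr_def vec_power_component
        power_powr_eq_inverse_power L_ge_2 u_init v_init del: minus_diff_eq)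
  have w_pos: "wp $ n > 0" "wm $ n > 0" for n
    using u_init[of n] v_init[of n] by (simp_all add: wp wm)
  \<comment> \<open>The weights turn the initial values u^L and v^L into squares, so
    \<open>\<beta>1\<close> and \<open>\<beta>_min\<close> are a sum and a minimum of squares for
    every L.\<close>
  have scale: "inverse x ^ (L - 2) * x ^ L = x\<^sup>2" if "x > 0" for x :: real
    unfolding power_eq_mult_square[OF L_ge_2] using that by (simp add: field_simps)
  have wu: "wp $ n * ut 0 $ n = (u 0 $ n)\<^sup>2" and wv: "wm $ n * vt 0 $ n = (v 0 $ n)\<^sup>2" for n
    unfolding wp wm ut_def vt_def vec_power_component by (intro scale u_init v_init)+
  have \<beta>1: "\<beta>1 = (\<Sum>n\<in>UNIV. (u 0 $ n)\<^sup>2 + (v 0 $ n)\<^sup>2)"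
    by (simp add: \<beta>1_def weighted_l1_norm_def l1_norm_def wu wv sum.distrib)
  have init_nz: "u 0 $ n \<noteq> 0" "v 0 $ n \<noteq> 0" for n
    using u_init[of n] v_init[of n] by simp_all
  then have \<beta>1_pos: "\<beta>1 > 0"
    unfolding \<beta>1 by (intro sum_pos add_pos_nonneg) auto
  have \<beta>_min: "\<beta>_min = (MIN n. min ((u 0 $ n)\<^sup>2) ((v 0 $ n)\<^sup>2))"
    unfolding \<beta>_min_def wu wv ..
  have \<beta>_min_pos: "\<beta>_min > 0"
    unfolding \<beta>_min by (simp add: init_nz)
  have "\<beta>_min \<le> min ((u 0 $ n)\<^sup>2) ((v 0 $ n)\<^sup>2)" for n
    unfolding \<beta>_min by (intro Min_le) auto
  then have \<beta>_min_le: "\<beta>_min \<le> (u 0 $ n)\<^sup>2" "\<beta>_min \<le> (v 0 $ n)\<^sup>2" for n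
    by simp_all
  have norm_eq: "signed_weighted_l1_norm wp wm z =
      (\<Sum>n\<in>UNIV. wp $ n * max (z $ n) 0 + wm $ n * max (- (z $ n)) 0)" for z
    by (intro signed_weighted_l1_norm_eq less_imp_le w_pos)

  have "closed S"
    unfolding S_def
    by (intro closed_Collect_eq continuous_intros
        linear_continuous_on[OF matrix_vector_mul_bounded_linear])
  then obtain z where z: "z \<in> S" "signed_weighted_l1_norm wp wm z = Q"
    using signed_weighted_l1_norm_attains_min[OF w_pos(1) w_pos(2), of S] assms(18) unfolding Q_def by blast
  obtain a b where ab: "\<And>n. a $ n \<ge> 0" "\<And>n. b $ n \<ge> 0" "z = a ^ L - b ^ L"
    "\<And>n. (a $ n) ^ L = max (z $ n) 0" "\<And>n. (b $ n) ^ L = max (- (z $ n)) 0"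
    using split_root[of L z] L_ge_2 by auto
  have feasible: "A *v (a ^ L - b ^ L) = y"
    using z(1) ab(3) by (simp add: S_def)
  have mass_ab: "weighted_mass a b = Q"
    by (simp add: weighted_mass_def ab(4,5) norm_eq wp wm flip: z(2))

  obtain p q where pq: "\<And>n. p $ n \<ge> 0" "\<And>n. q $ n \<ge> 0" "A *v (p ^ L - q ^ L) = y"
    "(u \<longlongrightarrow> p) at_top" "(v \<longlongrightarrow> q) at_top"
    using flow_converges[OF feasible ab(1,2)] by blast
  have lim: "((\<lambda>t. ut t - vt t) \<longlongrightarrow> p ^ L - q ^ L) at_top"
    unfolding ut_def vt_def by (intro tendsto_diff tendsto_vec_power pq)
  \<comment> \<open>Only an inequality, as p and q may both be positive in one coordinate.\<close>
  have norm_le_mass: "signed_weighted_l1_norm wp wm (p ^ L - q ^ L) \<le> weighted_mass p q"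
    unfolding norm_eq weighted_mass_def wp[symmetric] wm[symmetric]
    by (intro sum_mono add_mono mult_left_mono less_imp_le[OF w_pos(1)] less_imp_le[OF w_pos(2)])
      (simp_all add: vec_power_component pq)

  have "signed_weighted_l1_norm wp wm (p ^ L - q ^ L) - Q \<le> \<epsilon> * Q" if Q: "Q > \<beta>1"
  proof -
    \<comment> \<open>k solves k^L * \<open>\<beta>1\<close> = Q, the balance required above; K
      bounds all ratios a/u(0) and b/v(0), since each summand of the mass is at most Q.\<close>
    define k K where "k = (Q / \<beta>1) powr (1 / real L)" and "K = (Q / \<beta>_min) powr (1 / real L)"
    have Q_pos: "Q > 0" using Q \<beta>1_pos by simp
    have "Q / \<beta>1 > 1" using Q \<beta>1_pos by simp
    then have k: "k > 1" using L_ge_2 by (simp add: k_def)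
    have kL: "k ^ L * (\<Sum>n\<in>UNIV. (u 0 $ n)\<^sup>2 + (v 0 $ n)\<^sup>2) = weighted_mass a b"
      using Q_pos \<beta>1_pos L_ge_2 by (simp add: k_def powr_power mass_ab flip: \<beta>1)
    have summand: "inverse (u 0 $ n) ^ (L - 2) * (a $ n) ^ L + inverse (v 0 $ n) ^ (L - 2) * (b $ n) ^ L \<le> Q" for n
      unfolding mass_ab[symmetric] weighted_mass_def
      using ab(1,2) less_imp_le[OF u_init] less_imp_le[OF v_init]
      by (intro member_le_sum add_nonneg_nonneg mult_nonneg_nonneg zero_le_power) auto
    have nonneg: "0 \<le> inverse (u 0 $ n) ^ (L - 2) * (a $ n) ^ L" "0 \<le> inverse (v 0 $ n) ^ (L - 2) * (b $ n) ^ L" for n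
      using ab(1,2) less_imp_le[OF u_init] less_imp_le[OF v_init] by auto
    have aK: "a $ n \<le> K * u 0 $ n" for n
      unfolding K_def using summand[of n] nonneg(2)[of n]
      by (intro le_mult_root L_ge_2 u_init ab Q_pos \<beta>_min_pos \<beta>_min_le) auto
    have bK: "b $ n \<le> K * v 0 $ n" for n
      unfolding K_def using summand[of n] nonneg(1)[of n]
      by (intro le_mult_root L_ge_2 v_init ab Q_pos \<beta>_min_pos \<beta>_min_le) auto
    have k_pos: "k > 0" using k by simp
    have "psi_gain L k * (weighted_mass p q - Q) \<le> Q * (psi_margin L K - psi_margin L k)"
      using limit_mass_bound[OF pq ab(1,2) feasible aK bK k_pos kL] unfolding mass_ab .
    then have "weighted_mass p q - Q \<le> (psi_margin L K - psi_margin L k) / psi_gain L k * Q"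
      using psi_gain_pos[OF L_ge_2 k] by (simp add: field_simps)
    also have "(psi_margin L K - psi_margin L k) / psi_gain L k = \<epsilon>"
      unfolding k_def K_def margin_ratio[OF L_ge_2 \<beta>_min_pos \<beta>1_pos Q] \<epsilon>_def \<gamma>_def ..
    finally show ?thesis using norm_le_mass by simp
  qed
  with z lim pq(3) show ?thesis unfolding S_def by blast
qed

end
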